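(* Let $AB$ and $CD$ be two segments in $\mathbb{R}^2$, each of length at most one, that cross at a point $O$ interior to both segments. Put $$a=|AO|,\quad b=|BO|,\quad c=|CO|,\quad d=|DO|,$$ and suppose that the endpoints and the two segments are labeled so that $$a\le b,\qquad c\le d,\qquad a\le c$$ (which can always be achieved by relabeling the endpoints of each segment and interchanging the two segments if necessary). Then $$|CA|+|AD|\le\sqrt2.$$
   Context: For points $u,v\in\mathbb{R}^2$, $|uv|$ denotes the Euclidean distance between $u$ and $v$. A point is interior to a segment if it lies on the segment and is not one of its endpoints. *)

theory Defs
  imports "HOL-Analysis.Analysis"
begin

end

theory Submission
  imports Defs
begin

text \<open>
  Stewart's theorem expresses a weighted sum of \<open>|CA|\<^sup>2\<close> and \<open>|AD|\<^sup>2\<close> through \<open>|AP|\<close> and the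
  pieces \<open>c = |CP|\<close>, \<open>d = |PD|\<close> of \<open>CD\<close>. With the Cauchy-Schwarz inequality it gives
  \<open>(|CA| + |AD|)\<^sup>2 \<le> |CD|\<^sup>2 (1 + |AP|\<^sup>2 / (c d))\<close>. Here \<open>|CD| \<le> 1\<close>, and the labelling forces
  \<open>|AP|\<^sup>2 \<le> c d\<close>.
\<close>

lemma dist_convex_combination_squared:
  fixes A C D :: "'a::real_inner"
  shows "(dist A ((1 - u) *\<^sub>R C + u *\<^sub>R D))\<^sup>2
    = (1 - u) * (dist A C)\<^sup>2 + u * (dist A D)\<^sup>2 - u * (1 - u) * (dist C D)\<^sup>2"
proof -
  define p q where "p = A - C" and "q = A - D"
  have "A - ((1 - u) *\<^sub>R C + u *\<^sub>R D) = (1 - u) *\<^sub>R p + u *\<^sub>R q" and "C - D = q - p"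
    by (simp_all add: p_def q_def algebra_simps)
  moreover have "(norm ((1 - u) *\<^sub>R p + u *\<^sub>R q))\<^sup>2
      = (1 - u) * (norm p)\<^sup>2 + u * (norm q)\<^sup>2 - u * (1 - u) * (norm (q - p))\<^sup>2"
    unfolding power2_norm_eq_inner
    by (simp add: inner_add_left inner_add_right inner_diff_left inner_diff_right
        inner_commute[of q p] algebra_simps)
  ultimately show ?thesis
    by (simp add: dist_norm p_def q_def)
qed

lemma closed_segment_obtain_dist:
  fixes C D P :: "'a::real_normed_vector"
  assumes "P \<in> closed_segment C D"
  obtains u where "P = (1 - u) *\<^sub>R C + u *\<^sub>R D"
    and "dist C P = u * dist C D" and "dist P D = (1 - u) * dist C D"
proof -
  obtain u where u: "0 \<le> u" "u \<le> 1" and P: "P = (1 - u) *\<^sub>R C + u *\<^sub>R D"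
    using assms by (auto simp: in_segment)
  have "C - P = u *\<^sub>R (C - D)" and "P - D = (1 - u) *\<^sub>R (C - D)"
    by (simp_all add: P algebra_simps)
  then have "dist C P = u * dist C D" and "dist P D = (1 - u) * dist C D"
    using u by (simp_all add: dist_norm)
  with P show thesis
    by (rule that)
qed

lemma dist_add_closed_segment:
  fixes C D P :: "'a::real_normed_vector"
  assumes "P \<in> closed_segment C D"
  shows "dist C P + dist P D = dist C D"
  using assms by (elim closed_segment_obtain_dist) (simp add: algebra_simps)

theorem stewart:
  fixes A C D P :: "'a::real_inner"
  assumes "P \<in> closed_segment C D"
  shows "dist P D * (dist C A)\<^sup>2 + dist C P * (dist A D)\<^sup>2
    = dist C D * ((dist A P)\<^sup>2 + dist C P * dist P D)"
proof -
  obtain u where P: "P = (1 - u) *\<^sub>R C + u *\<^sub>R D"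
    and dist_pieces: "dist C P = u * dist C D" "dist P D = (1 - u) * dist C D"
    using assms by (rule closed_segment_obtain_dist)
  have AP_squared:
    "(dist A P)\<^sup>2 = (1 - u) * (dist C A)\<^sup>2 + u * (dist A D)\<^sup>2 - u * (1 - u) * (dist C D)\<^sup>2"
    unfolding P dist_commute[of C A] by (rule dist_convex_combination_squared)
  show ?thesis
    unfolding dist_pieces AP_squared by (simp add: power2_eq_square algebra_simps)
qed

lemma weighted_sum_squared_le:
  fixes c d x y :: "'a::linordered_idom"
  shows "c * d * (x + y)\<^sup>2 \<le> (c + d) * (d * x\<^sup>2 + c * y\<^sup>2)"
proof -
  have "(c + d) * (d * x\<^sup>2 + c * y\<^sup>2) = c * d * (x + y)\<^sup>2 + (d * x - c * y)\<^sup>2"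
    by (simp add: power2_eq_square algebra_simps)
  then show ?thesis
    by simp
qed

lemma sum_dist_endpoints_squared_le:
  fixes A C D P :: "'a::real_inner"
  assumes "P \<in> closed_segment C D"
  shows "dist C P * dist P D * (dist C A + dist A D)\<^sup>2
    \<le> (dist C D)\<^sup>2 * ((dist A P)\<^sup>2 + dist C P * dist P D)"
proof -
  have "dist C P * dist P D * (dist C A + dist A D)\<^sup>2
      \<le> (dist C P + dist P D) * (dist P D * (dist C A)\<^sup>2 + dist C P * (dist A D)\<^sup>2)"
    by (rule weighted_sum_squared_le)
  also have "\<dots> = (dist C D)\<^sup>2 * ((dist A P)\<^sup>2 + dist C P * dist P D)"
    unfolding dist_add_closed_segment[OF assms] stewart[OF assms]
    by (simp add: power2_eq_square)
  finally show ?thesis .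
qed

lemma sum_dist_endpoints_le_sqrt2_mult:
  fixes A C D P :: "'a::real_inner"
  assumes P: "P \<in> closed_segment C D" and AP: "(dist A P)\<^sup>2 \<le> dist C P * dist P D"
  shows "dist C A + dist A D \<le> sqrt 2 * dist C D"
proof (cases "A = P")
  case True
  then have "dist C A + dist A D = dist C D"
    using dist_add_closed_segment[OF P] by simp
  also have "\<dots> \<le> sqrt 2 * dist C D"
    by (simp add: mult_le_cancel_right1)
  finally show ?thesis .
next
  case False
  then have "0 < (dist A P)\<^sup>2"
    by simp
  with AP have "0 < dist C P * dist P D"
    by linarith
  moreover have "dist C P * dist P D * (dist C A + dist A D)\<^sup>2
      \<le> dist C P * dist P D * (2 * (dist C D)\<^sup>2)"
  proof -
    have "dist C P * dist P D * (dist C A + dist A D)\<^sup>2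
        \<le> (dist C D)\<^sup>2 * ((dist A P)\<^sup>2 + dist C P * dist P D)"
      using P by (rule sum_dist_endpoints_squared_le)
    also have "\<dots> \<le> (dist C D)\<^sup>2 * (2 * (dist C P * dist P D))"
      using AP by (intro mult_left_mono) simp_all
    finally show ?thesis
      by (simp add: mult_ac)
  qed
  ultimately have "(dist C A + dist A D)\<^sup>2 \<le> 2 * (dist C D)\<^sup>2"
    by (simp only: mult_le_cancel_left_pos)
  then have "dist C A + dist A D \<le> sqrt (2 * (dist C D)\<^sup>2)"
    by (rule real_le_rsqrt)
  then show ?thesis
    by (simp add: real_sqrt_mult)
qed

theorem lemma1:
  fixes A B C D P :: "real^2" and a b c d :: real
  assumes "dist A B \<le> 1" and "dist C D \<le> 1"
    and "closed_segment A B \<inter> closed_segment C D = {P}"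
    and "P \<in> open_segment A B" and "P \<in> open_segment C D"
    and "a = dist A P" and "b = dist B P" and "c = dist C P" and "d = dist D P"
    and "a \<le> b" and "c \<le> d" and "a \<le> c"
  shows "dist C A + dist A D \<le> sqrt 2"
proof -
  have "P \<in> closed_segment C D"
    using assms(3) by blast
  moreover have "(dist A P)\<^sup>2 \<le> dist C P * dist P D"
    unfolding power2_eq_square dist_commute[of P D] using assms by (intro mult_mono) simp_all
  ultimately have "dist C A + dist A D \<le> sqrt 2 * dist C D"
    by (rule sum_dist_endpoints_le_sqrt2_mult)
  also have "\<dots> \<le> sqrt 2"
    using \<open>dist C D \<le> 1\<close> by simp
  finally show ?thesis .
qed

end
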